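(* Let $V=(V_t)_{t\ge 0}$ be an $\mathbb{R}^d$-valued progressively measurable process, regular enough that $\phi^u_t$ is measurable, and such that $\mathbb{P}(\phi^u_t=b)=0$ for every $u\in S^{d-1}$, $t>0$ and $b\in\mathbb{R}\cup\{\pm\infty\}$. Fix a centre point $x\in\mathbb{R}^d$, and for a function $C:S^{d-1}\to\mathbb{R}$ define $$\mathcal{B}_C=\operatorname{cl}\left(\operatorname{conv}\left(\left\{x+u\,(C(u)-\langle u,x\rangle)^+:u\in S^{d-1}\right\}\right)\right).$$ (1) Fix some $t_s\in(0,\infty)$, $q_s\in(0,1)$ such that $C_Q(u)$ is well defined for all $u\in S^{d-1}$ and bounded from above. Let $\mathcal{B}=\mathcal{B}_{C_Q}$. Then $\partial\mathcal{B}$ is a valid contour in the quantile sense, i.e. $\mathcal{B}$ is convex and compact and $Q_s(\mathcal{B})\ge q_s$. (2) Similarly, if $C_T$ is well defined and bounded above on $S^{d-1}$ for some $t_r\in(0,\infty)$ and $\widehat{\mathcal{B}}=\mathcal{B}_{C_T}$, then $\partial\widehat{\mathcal{B}}$ is a valid contour in the return period sense, i.e. $\widehat{\mathcal{B}}$ is convex and compact and $T_r(\widehat{\mathcal{B}})\ge t_r$.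
   Context: Fix $d\ge1$, $S^{d-1}=\{v\in\mathbb{R}^d:\|v\|=1\}$ (Euclidean norm, inner product $\langle\cdot,\cdot\rangle$). $\operatorname{conv}$ is the convex hull, $\operatorname{cl}$ the closure, $(a)^+=\max(a,0)$. The point $x$ is ideally, but not necessarily, such that $C(u)-\langle u,x\rangle>0$ for all $u\in S^{d-1}$. For $u\in S^{d-1}$, $b\in\mathbb{R}$, let $\Pi^+(u,b)=\{v\in\mathbb{R}^d:\langle u,v\rangle\ge b\}$. For a set $A\subseteq\mathbb{R}^d$ the hitting time is $\tau_A=\inf\{t\ge0:V_t\in A\}$, with $\inf\emptyset=+\infty$; hitting times are taken to be random variables. $\phi^u_t=\sup_{s\in[0,t]}\langle V_s,u\rangle$ (extended-real-valued). The regularity making $\phi^u_t$ measurable is not further specified; for instance càdlàg paths, or a discrete model for $V$, may be assumed. For a compact convex $\mathcal{B}\subset\mathbb{R}^d$, $\mathcal{E}(\mathcal{B})$ is the class of all convex sets $\mathcal{F}\subseteq\mathbb{R}^d$ with $\mathcal{F}\cap\mathcal{B}\subseteq\partial\mathcal{B}$, where $\partial\mathcal{B}$ is the boundary of $\mathcal{B}$. Put $$Q_s(\mathcal{B})=\inf_{\mathcal{F}\in\mathcal{E}(\mathcal{B})}\mathbb{P}(\tau_{\mathcal{F}}>t_s),\qquad T_r(\mathcal{B})=\inf_{\mathcal{F}\in\mathcal{E}(\mathcal{B})}\mathbb{E}[\tau_{\mathcal{F}}].$$ Define $$C_Q(u)=\inf\{b\in\mathbb{R}:\mathbb{P}(\tau_{\Pi^+(u,b)}>t_s)=q_s\},\qquad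 C_T(u)=\inf\{b\in\mathbb{R}:\mathbb{E}[\tau_{\Pi^+(u,b)}]=t_r\};$$ such a value is called well defined if the set over which the infimum is taken is nonempty and the infimum is finite.
   Formalization: Part (1) additionally assumes almost surely right-continuous paths; the bounds are proved with the boundary of B taken relative to its affine hull, and with the topological boundary only when B has nonempty interior, since the claim fails otherwise. *)

theory Defs
  imports "HOL-Probability.Probability"
begin

definition progressively_measurable ::
  "(real \<Rightarrow> 'w measure) \<Rightarrow> (real \<Rightarrow> 'w \<Rightarrow> 'a::euclidean_space) \<Rightarrow> bool" where
  "progressively_measurable F V \<longleftrightarrow>
     (\<forall>t\<ge>0. (\<lambda>(s, \<omega>). V s \<omega>) \<in> borel_measurable (restrict_space borel {0..t} \<Otimes>\<^sub>M F t))"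

definition right_continuous_paths ::
  "'w measure \<Rightarrow> (real \<Rightarrow> 'w \<Rightarrow> 'a::euclidean_space) \<Rightarrow> bool" where
  "right_continuous_paths M V \<longleftrightarrow>
     (AE \<omega> in M. \<forall>t\<ge>0. continuous (at_right t) (\<lambda>s. V s \<omega>))"

definition running_sup ::
  "(real \<Rightarrow> 'w \<Rightarrow> 'a::euclidean_space) \<Rightarrow> 'a \<Rightarrow> real \<Rightarrow> 'w \<Rightarrow> ereal" where
  "running_sup V u t \<omega> = (SUP s\<in>{0..t}. ereal (V s \<omega> \<bullet> u))"

text \<open>The infimum is taken in \<^typ>\<open>ennreal\<close>, so that it is \<infinity> if the set is never hit.\<close>

definition hitting_time ::
  "(real \<Rightarrow> 'w \<Rightarrow> 'a::euclidean_space) \<Rightarrow> 'a set \<Rightarrow> 'w \<Rightarrow> ennreal" where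
  "hitting_time V A \<omega> = Inf {ennreal t |t. 0 \<le> t \<and> V t \<omega> \<in> A}"

definition halfspace_ge :: "'a::euclidean_space \<Rightarrow> real \<Rightarrow> 'a set" where
  "halfspace_ge u b = {v. u \<bullet> v \<ge> b}"

definition survival_prob ::
  "'w measure \<Rightarrow> (real \<Rightarrow> 'w \<Rightarrow> 'a::euclidean_space) \<Rightarrow> real \<Rightarrow> 'a set \<Rightarrow> real" where
  "survival_prob M V ts A = \<P>(\<omega> in M. hitting_time V A \<omega> > ennreal ts)"

definition mean_hitting_time ::
  "'w measure \<Rightarrow> (real \<Rightarrow> 'w \<Rightarrow> 'a::euclidean_space) \<Rightarrow> 'a set \<Rightarrow> ennreal" where
  "mean_hitting_time M V A = (\<integral>\<^sup>+\<omega>. hitting_time V A \<omega> \<partial>M)"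

text \<open>The boundary operator is a parameter, to be taken as \<^const>\<open>frontier\<close> (topological
  boundary) or \<^const>\<open>rel_frontier\<close> (boundary relative to the affine hull). The two agree
  whenever \<open>B\<close> has nonempty interior. If a closed convex set \<open>B\<close> has empty interior, then
  \<open>frontier B = B\<close>, so the whole space belongs to \<open>outer_sets frontier B\<close> and both infima
  below degenerate to 0; the relative boundary is the meaningful one in that case.\<close>

definition outer_sets ::
  "('a::euclidean_space set \<Rightarrow> 'a set) \<Rightarrow> 'a set \<Rightarrow> 'a set set" where
  "outer_sets bd B = {F. convex F \<and> F \<inter> B \<subseteq> bd B}"

definition Q_s ::
  "('a::euclidean_space set \<Rightarrow> 'a set) \<Rightarrow> 'w measure \<Rightarrow> (real \<Rightarrow> 'w \<Rightarrow> 'a) \<Rightarrow> real \<Rightarrow> 'a set \<Rightarrow> real"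
  where "Q_s bd M V ts B = (INF F\<in>outer_sets bd B. survival_prob M V ts F)"

definition T_r ::
  "('a::euclidean_space set \<Rightarrow> 'a set) \<Rightarrow> 'w measure \<Rightarrow> (real \<Rightarrow> 'w \<Rightarrow> 'a) \<Rightarrow> 'a set \<Rightarrow> ennreal"
  where "T_r bd M V B = (INF F\<in>outer_sets bd B. mean_hitting_time M V F)"

definition CQ_set ::
  "'w measure \<Rightarrow> (real \<Rightarrow> 'w \<Rightarrow> 'a::euclidean_space) \<Rightarrow> real \<Rightarrow> real \<Rightarrow> 'a \<Rightarrow> real set" where
  "CQ_set M V ts qs u = {b. survival_prob M V ts (halfspace_ge u b) = qs}"

definition CT_set ::
  "'w measure \<Rightarrow> (real \<Rightarrow> 'w \<Rightarrow> 'a::euclidean_space) \<Rightarrow> real \<Rightarrow> 'a \<Rightarrow> real set" where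
  "CT_set M V tr u = {b. mean_hitting_time M V (halfspace_ge u b) = ennreal tr}"

definition C_Q ::
  "'w measure \<Rightarrow> (real \<Rightarrow> 'w \<Rightarrow> 'a::euclidean_space) \<Rightarrow> real \<Rightarrow> real \<Rightarrow> 'a \<Rightarrow> real" where
  "C_Q M V ts qs u = Inf (CQ_set M V ts qs u)"

definition C_T ::
  "'w measure \<Rightarrow> (real \<Rightarrow> 'w \<Rightarrow> 'a::euclidean_space) \<Rightarrow> real \<Rightarrow> 'a \<Rightarrow> real" where
  "C_T M V tr u = Inf (CT_set M V tr u)"

text \<open>The infimum of a nonempty set of reals is finite iff the set is bounded below.\<close>

definition well_defined_Inf :: "real set \<Rightarrow> bool" where
  "well_defined_Inf S \<longleftrightarrow> S \<noteq> {} \<and> bdd_below S"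

definition contour_body ::
  "'a::euclidean_space \<Rightarrow> ('a \<Rightarrow> real) \<Rightarrow> 'a set" where
  "contour_body x C =
     closure (convex hull ((\<lambda>u. x + max (C u - u \<bullet> x) 0 *\<^sub>R u) ` sphere 0 1))"

end

theory Submission
  imports Defs
begin

text \<open>A convex set that meets a compact convex \<open>B\<close> only in its relative boundary is separated
  from \<open>B\<close> by a hyperplane with unit normal \<open>u\<close>. Since \<open>B\<close> contains \<open>x + u (C u - \<langle>u, x\<rangle>)\<^sup>+\<close>, this
  puts the set inside the half-space \<open>\<langle>u, v\<rangle> \<ge> C u\<close>, so only the hitting times of half-spaces
  matter. For these, the events \<open>\<tau>\<^sub>b > t\<close> and \<open>\<phi>\<^sub>t < b\<close> differ, up to right limits of the path, only
  on the null event \<open>\<phi>\<^sub>t = b\<close>; hence the survival probability and the mean hitting time are right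
  continuous in \<open>b\<close>, and the infimum defining \<open>C u\<close> is attained.\<close>

section \<open>Separation from the contour body\<close>

lemma convex_contour_body [simp]: "convex (contour_body x C)"
  unfolding contour_body_def by (simp add: convex_closure)

text \<open>An upper bound on \<open>C\<close> suffices: the positive part cuts off from below, and
  Cauchy-Schwarz bounds \<open>u \<bullet> x\<close> by \<open>norm x\<close>, so the generating
  points are bounded. Convex hull and closure preserve this.\<close>

lemma compact_contour_body:
  assumes "bdd_above (C ` sphere 0 1)"
  shows "compact (contour_body x C)"
proof -
  obtain K where K: "C u \<le> K" if "u \<in> sphere 0 1" for u
    using assms by (force simp: bdd_above_def)
  have "bounded ((\<lambda>u. x + max (C u - u \<bullet> x) 0 *\<^sub>R u) ` sphere 0 1)"
    unfolding bounded_iff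
  proof (intro exI ballI, elim imageE, hypsubst)
    fix u :: 'a assume u: "u \<in> sphere 0 1"
    have "\<bar>u \<bullet> x\<bar> \<le> norm x"
      using Cauchy_Schwarz_ineq2[of u x] u by simp
    with K[OF u] have m: "max (C u - u \<bullet> x) 0 \<le> \<bar>K\<bar> + norm x"
      by auto
    have "norm (x + max (C u - u \<bullet> x) 0 *\<^sub>R u) \<le> norm x + norm (max (C u - u \<bullet> x) 0 *\<^sub>R u)"
      by (rule norm_triangle_ineq)
    also have "\<dots> = norm x + max (C u - u \<bullet> x) 0"
      using u by simp
    also note m
    finally show "norm (x + max (C u - u \<bullet> x) 0 *\<^sub>R u) \<le> norm x + (\<bar>K\<bar> + norm x)"
      by simp
  qed
  then show ?thesis
    unfolding contour_body_def by (simp add: bounded_convex_hull)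
qed

text \<open>The generating point in direction \<open>u\<close> has inner product
  \<open>max (C u) (u \<bullet> x)\<close> with \<open>u\<close>, so the support function of the
  body dominates \<open>C\<close>.\<close>

lemma contour_body_support:
  assumes "u \<in> sphere 0 1" and le: "\<And>y. y \<in> contour_body x C \<Longrightarrow> u \<bullet> y \<le> c"
  shows "C u \<le> c"
proof -
  let ?y = "x + max (C u - u \<bullet> x) 0 *\<^sub>R u"
  have "?y \<in> contour_body x C"
    unfolding contour_body_def using assms(1) by (meson closure_subset hull_subset imageI subsetD)
  then have "u \<bullet> ?y \<le> c"
    by (rule le)
  moreover have "u \<bullet> u = 1"
    using assms(1) by (simp add: dot_square_norm)
  ultimately show ?thesis
    by (simp add: inner_add_right)
qed

lemma outer_set_subset_halfspace:
  fixes x :: "'a::euclidean_space"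
  assumes "A \<in> outer_sets rel_frontier (contour_body x C)"
  obtains u where "u \<in> sphere 0 1" "A \<subseteq> halfspace_ge u (C u)"
proof (cases "A = {}")
  case True
  \<comment> \<open>The separation theorem requires nonempty sets. The empty set lies in every
    half-space, so any unit vector serves.\<close>
  obtain u :: 'a where "u \<in> Basis"
    using nonempty_Basis by blast
  then show ?thesis
    using that[of u] True by simp
next
  case False
  let ?B = "contour_body x C"
  have A: "convex A" "A \<inter> ?B \<subseteq> rel_frontier ?B"
    using assms by (auto simp: outer_sets_def)
  obtain e :: 'a where "e \<in> Basis"
    using nonempty_Basis by blast
  then have "sphere (0::'a) 1 \<noteq> {}"
    by force
  then have "?B \<noteq> {}"
    by (simp add: contour_body_def)
  then have ne: "rel_interior ?B \<noteq> {}"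
    by (simp add: rel_interior_eq_empty)
  have "rel_interior ?B \<inter> A = {}"
    using A(2) rel_interior_subset[of ?B] by (auto simp: rel_frontier_def)
  from separating_hyperplane_sets[OF _ A(1) ne False this]
  obtain a c where a: "a \<noteq> 0"
    and le: "\<And>y. y \<in> rel_interior ?B \<Longrightarrow> a \<bullet> y \<le> c" and ge: "\<And>y. y \<in> A \<Longrightarrow> c \<le> a \<bullet> y"
    by (auto simp: convex_rel_interior)
  define u where "u = sgn a"
  have u: "u \<in> sphere 0 1"
    using a by (simp add: u_def norm_sgn)
  have inner_u: "u \<bullet> y = a \<bullet> y / norm a" for y
    by (simp add: u_def sgn_div_norm divide_inverse mult.commute)
  \<comment> \<open>Separation bounds only the relative interior; the bound extends to the whole
    body because a convex set lies in the closure of its relative interior.\<close>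
  have "closure (rel_interior ?B) \<subseteq> {y. a \<bullet> y \<le> c}"
    using le by (intro closure_minimal closed_halfspace_le) auto
  then have "a \<bullet> y \<le> c" if "y \<in> ?B" for y
    using that closure_subset[of ?B] by (auto simp: convex_closure_rel_interior)
  then have "C u \<le> c / norm a"
    by (intro contour_body_support[where C = C and x = x, OF u])
      (simp add: inner_u divide_right_mono)
  moreover have "c / norm a \<le> u \<bullet> y" if "y \<in> A" for y
    using ge[OF that] by (simp add: inner_u divide_right_mono)
  ultimately have "A \<subseteq> halfspace_ge u (C u)"
    unfolding halfspace_ge_def by fastforce
  with u show ?thesis
    by (rule that)
qed

lemma outer_sets_frontier:
  "interior B \<noteq> {} \<Longrightarrow> outer_sets frontier B = outer_sets rel_frontier B"
  by (simp add: outer_sets_def rel_frontier_nonempty_interior)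

section \<open>Hitting times and the running supremum\<close>

lemma hitting_time_le: "0 \<le> t \<Longrightarrow> V t \<omega> \<in> A \<Longrightarrow> hitting_time V A \<omega> \<le> ennreal t"
  unfolding hitting_time_def by (rule Inf_lower) auto

lemma hitting_time_lessD:
  assumes "hitting_time V A \<omega> < ennreal t"
  obtains s where "0 \<le> s" "s < t" "V s \<omega> \<in> A"
  using assms unfolding hitting_time_def Inf_less_iff by (auto simp: ennreal_less_iff)

lemma hitting_time_antimono: "A \<subseteq> B \<Longrightarrow> hitting_time V B \<omega> \<le> hitting_time V A \<omega>"
  unfolding hitting_time_def by (rule Inf_superset_mono) auto

lemma convex_halfspace_ge' [simp]: "convex (halfspace_ge u b)"
  unfolding halfspace_ge_def by (rule convex_halfspace_ge)

lemma halfspace_ge_antimono: "b \<le> c \<Longrightarrow> halfspace_ge u c \<subseteq> halfspace_ge u b"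
  by (auto simp: halfspace_ge_def)

text \<open>Survival keeps the path strictly below level \<open>b\<close> at each time up to
  \<open>t\<close>, but the supremum may reach \<open>b\<close> without being attained, so only the
  weak inequality survives.\<close>

lemma running_sup_le_if_hitting_time_gt:
  assumes "ennreal t < hitting_time V (halfspace_ge u b) \<omega>"
  shows "running_sup V u t \<omega> \<le> ereal b"
  unfolding running_sup_def
proof (rule SUP_least)
  fix s assume s: "s \<in> {0..t}"
  then have "ennreal s < hitting_time V (halfspace_ge u b) \<omega>"
    using assms by (meson atLeastAtMost_iff ennreal_leI order_le_less_trans)
  then have "V s \<omega> \<notin> halfspace_ge u b"
    using hitting_time_le[of s V \<omega>] s by force
  then show "ereal (V s \<omega> \<bullet> u) \<le> ereal b"
    by (simp add: halfspace_ge_def inner_commute)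
qed

lemma running_sup_ge_if_hit:
  "0 \<le> s \<Longrightarrow> s \<le> t \<Longrightarrow> V s \<omega> \<in> halfspace_ge u b \<Longrightarrow> ereal b \<le> running_sup V u t \<omega>"
  unfolding running_sup_def halfspace_ge_def
  by (rule SUP_upper2[of s]) (auto simp: inner_commute)

lemma running_sup_ge_if_hitting_time_less:
  "hitting_time V (halfspace_ge u b) \<omega> < ennreal t \<Longrightarrow> ereal b \<le> running_sup V u t \<omega>"
  by (elim hitting_time_lessD) (auto intro: running_sup_ge_if_hit)

text \<open>When the hitting time equals \<open>t\<close>, visits may merely accumulate at
  \<open>t\<close> from the right. If the supremum were below \<open>b\<close>, right continuity
  would keep the path below \<open>b\<close> slightly beyond \<open>t\<close>, contradicting such
  visits.\<close>

lemma running_sup_ge_if_hitting_time_le: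
  assumes "0 \<le> t" and cont: "continuous (at_right t) (\<lambda>s. V s \<omega>)"
    and le: "hitting_time V (halfspace_ge u b) \<omega> \<le> ennreal t"
  shows "ereal b \<le> running_sup V u t \<omega>"
proof (rule ccontr)
  assume not: "\<not> ereal b \<le> running_sup V u t \<omega>"
  then have *: "u \<bullet> V s \<omega> < b" if "0 \<le> s" "s \<le> t" for s
    using running_sup_ge_if_hit[of s t V \<omega> u b] that by (force simp: halfspace_ge_def)
  have "((\<lambda>s. u \<bullet> V s \<omega>) \<longlongrightarrow> u \<bullet> V t \<omega>) (at_right t)"
    using cont by (intro tendsto_intros) (simp add: continuous_within)
  then have "\<forall>\<^sub>F s in at_right t. u \<bullet> V s \<omega> < b"
    using * \<open>0 \<le> t\<close> by (intro order_tendstoD) auto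
  then obtain r where r: "r > t" "\<And>s. t < s \<Longrightarrow> s < r \<Longrightarrow> u \<bullet> V s \<omega> < b"
    by (auto simp: eventually_at_right_field)
  have "hitting_time V (halfspace_ge u b) \<omega> < ennreal r"
    using le r(1) \<open>0 \<le> t\<close> by (meson ennreal_lessI order_le_less_trans order_less_trans le_less_trans)
  then obtain s where "0 \<le> s" "s < r" "V s \<omega> \<in> halfspace_ge u b"
    by (rule hitting_time_lessD)
  then show False
    using *[of s] r(2)[of s] by (force simp: halfspace_ge_def)
qed

section \<open>The infima are attained\<close>

lemma Inf_add_inverse_greater:
  fixes S :: "real set"
  assumes "S \<noteq> {}"
  obtains b where "b \<in> S" "b < Inf S + inverse (real (Suc n))"
  using cInf_lessD[OF assms, of "Inf S + inverse (real (Suc n))"] by auto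

context prob_space
begin

text \<open>Survival at level \<open>b\<close> implies \<open>running_sup\<close> at most
  \<open>b\<close>, and members of \<open>CQ_set\<close> lie arbitrarily close above the infimum
  \<open>c\<close>. Continuity of the measure from above brings the bound \<open>q\<close> down to
  level \<open>c\<close>, where almost surely the converse implication holds.\<close>

lemma survival_prob_C_Q_ge:
  assumes t: "0 < t" and rc: "right_continuous_paths M V"
    and hit: "\<And>b. hitting_time V (halfspace_ge u b) \<in> borel_measurable M"
    and sup [measurable]: "running_sup V u t \<in> borel_measurable M"
    and atomless: "\<And>b. prob {\<omega> \<in> space M. running_sup V u t \<omega> = ereal b} = 0"
    and wd: "well_defined_Inf (CQ_set M V t q u)"
  shows "q \<le> survival_prob M V t (halfspace_ge u (C_Q M V t q u))"
proof -
  define c where "c = C_Q M V t q u"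
  \<comment> \<open>The weak inequality makes the intersection over levels decreasing to
    \<open>c\<close> exactly \<open>D c\<close>; with a strict one it would not be.\<close>
  define D where "D b = {\<omega> \<in> space M. running_sup V u t \<omega> \<le> ereal b}" for b
  have D [measurable]: "D b \<in> sets M" for b
    unfolding D_def by measurable
  have [measurable]: "{\<omega> \<in> space M. hitting_time V (halfspace_ge u b) \<omega> > ennreal t} \<in> sets M" for b
    using hit[of b] by measurable
  have D_ge: "q \<le> prob (D (c + inverse (real (Suc n))))" for n
  proof -
    obtain b where b: "b \<in> CQ_set M V t q u" "b < c + inverse (real (Suc n))"
      using wd unfolding c_def C_Q_def well_defined_Inf_def by (meson Inf_add_inverse_greater)
    have "q = survival_prob M V t (halfspace_ge u b)"
      using b(1) by (simp add: CQ_set_def)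
    also have "\<dots> \<le> prob (D (c + inverse (real (Suc n))))"
      unfolding survival_prob_def
    proof (rule finite_measure_mono)
      show "{\<omega> \<in> space M. ennreal t < hitting_time V (halfspace_ge u b) \<omega>}
          \<subseteq> D (c + inverse (real (Suc n)))"
        using b(2) by (auto simp: D_def dest!: running_sup_le_if_hitting_time_gt
            intro: order_trans[of _ "ereal b"])
    qed simp
    finally show ?thesis .
  qed
  have "decseq (\<lambda>n. D (c + inverse (real (Suc n))))"
    unfolding decseq_def D_def
  proof (intro allI impI subsetI, clarsimp simp del: of_nat_Suc)
    fix m n :: nat and \<omega>
    assume "m \<le> n" and le: "running_sup V u t \<omega> \<le> ereal (c + inverse (real (Suc n)))"
    then have "inverse (real (Suc n)) \<le> inverse (real (Suc m))"
      by (intro le_imp_inverse_le) auto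
    then show "running_sup V u t \<omega> \<le> ereal (c + inverse (real (Suc m)))"
      using le by (elim order_trans) simp
  qed
  then have "(\<lambda>n. prob (D (c + inverse (real (Suc n)))))
      \<longlonglongrightarrow> prob (\<Inter>n. D (c + inverse (real (Suc n))))"
    by (intro finite_Lim_measure_decseq) auto
  also have "(\<Inter>n. D (c + inverse (real (Suc n)))) = D c"
  proof (intro set_eqI iffI)
    fix \<omega> assume \<omega>: "\<omega> \<in> (\<Inter>n. D (c + inverse (real (Suc n))))"
    have "(\<lambda>n. ereal (c + inverse (real (Suc n)))) \<longlonglongrightarrow> ereal (c + 0)"
      by (intro tendsto_intros LIMSEQ_inverse_real_of_nat)
    then have "running_sup V u t \<omega> \<le> ereal (c + 0)"
      by (rule LIMSEQ_le_const) (use \<omega> in \<open>auto simp: D_def\<close>)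
    then show "\<omega> \<in> D c"
      using \<omega> by (auto simp: D_def)
  next
    fix \<omega> assume "\<omega> \<in> D c"
    then show "\<omega> \<in> (\<Inter>n. D (c + inverse (real (Suc n))))"
      by (auto simp: D_def intro: order_trans[of _ "ereal c"])
  qed
  finally have "q \<le> prob (D c)"
    by (rule LIMSEQ_le_const) (use D_ge in auto)
  also have "prob (D c) \<le> survival_prob M V t (halfspace_ge u c)"
    unfolding survival_prob_def
  proof (rule finite_measure_mono_AE)
    \<comment> \<open>Removing the null event of equality makes the supremum strictly less than
      \<open>c\<close> on \<open>D c\<close>, which rules out a hitting time at most
      \<open>t\<close>.\<close>
    have "AE \<omega> in M. running_sup V u t \<omega> \<noteq> ereal c"
      using atomless[of c] prob_Collect_eq_0[of "\<lambda>\<omega>. running_sup V u t \<omega> = ereal c"]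
      by simp
    then show "AE \<omega> in M. \<omega> \<in> D c \<longrightarrow>
        \<omega> \<in> {\<omega> \<in> space M. ennreal t < hitting_time V (halfspace_ge u c) \<omega>}"
      using rc[unfolded right_continuous_paths_def]
    proof eventually_elim
      case (elim \<omega>)
      show ?case
      proof
        assume "\<omega> \<in> D c"
        with elim(1) have "\<not> ereal c \<le> running_sup V u t \<omega>" "\<omega> \<in> space M"
          by (auto simp: D_def)
        then show "\<omega> \<in> {\<omega> \<in> space M. ennreal t < hitting_time V (halfspace_ge u c) \<omega>}"
          using running_sup_ge_if_hitting_time_le[of t V \<omega> u c] elim(2) t by force
      qed
    qed
  qed simp
  finally show ?thesis
    by (simp add: c_def)
qed

text \<open>If the two sides differ, some rational time \<open>r\<close> lies strictly between them.
  A visit to level \<open>c\<close> before \<open>r\<close> gives \<open>running_sup\<close> at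
  least \<open>c\<close>, and survival of every level \<open>a n\<close> past \<open>r\<close> gives
  at most \<open>c\<close>. Equality at \<open>r\<close> is a null event, and there are only
  countably many such \<open>r\<close>.\<close>

lemma AE_hitting_time_halfspace_ge_eq_INF:
  assumes sup: "\<And>t. 0 \<le> t \<Longrightarrow> running_sup V u t \<in> borel_measurable M"
    and atomless: "\<And>t. 0 < t \<Longrightarrow> prob {\<omega> \<in> space M. running_sup V u t \<omega> = ereal c} = 0"
    and a: "a \<longlonglongrightarrow> c" and ge: "\<And>n. c \<le> a n"
  shows "AE \<omega> in M. hitting_time V (halfspace_ge u c) \<omega>
    = (INF n. hitting_time V (halfspace_ge u (a n)) \<omega>)"
proof -
  have "AE \<omega> in M. \<forall>r\<in>{r\<in>\<rat>. 0 < r}. running_sup V u r \<omega> \<noteq> ereal c"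
  proof (rule AE_ball_countable')
    fix r :: real assume r: "r \<in> {r\<in>\<rat>. 0 < r}"
    then have [measurable]: "running_sup V u r \<in> borel_measurable M"
      by (intro sup) auto
    show "AE \<omega> in M. running_sup V u r \<omega> \<noteq> ereal c"
      using atomless[of r] r prob_Collect_eq_0[of "\<lambda>\<omega>. running_sup V u r \<omega> = ereal c"]
      by simp
  qed (auto intro: countable_subset[OF _ countable_rat])
  then show ?thesis
  proof eventually_elim
    case (elim \<omega>)
    let ?h = "\<lambda>b. hitting_time V (halfspace_ge u b) \<omega>"
    show ?case
    proof (rule ccontr)
      assume "?h c \<noteq> (INF n. ?h (a n))"
      moreover have "?h c \<le> (INF n. ?h (a n))"
        using ge by (intro INF_greatest hitting_time_antimono halfspace_ge_antimono)
      ultimately have "?h c < (INF n. ?h (a n))"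
        by simp
      then obtain r where "r \<in> \<rat>" and r': "?h c < ennreal r" "ennreal r < (INF n. ?h (a n))"
        using ennreal_rat_dense by (metis Rats_of_rat)
      moreover have "0 < r"
        using r'(1) by (metis ennreal_neg not_less not_less_zero)
      ultimately have r: "r \<in> \<rat>" "0 < r" "?h c < ennreal r" "ennreal r < (INF n. ?h (a n))"
        by auto
      have "running_sup V u r \<omega> \<le> ereal (a n)" for n
        by (intro running_sup_le_if_hitting_time_gt less_INF_D[OF r(4)]) simp
      moreover have "(\<lambda>n. ereal (a n)) \<longlonglongrightarrow> ereal c"
        using a by simp
      ultimately have "running_sup V u r \<omega> \<le> ereal c"
        by (meson LIMSEQ_le_const)
      moreover have "ereal c \<le> running_sup V u r \<omega>"
        using r(3) by (rule running_sup_ge_if_hitting_time_less)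
      ultimately show False
        using elim r(1,2) by auto
    qed
  qed
qed

text \<open>Along levels decreasing to the infimum the mean is constantly \<open>tr\<close>, and the
  hitting times decrease almost surely to the one at the infimum. Monotone convergence then
  transfers the value.\<close>

lemma mean_hitting_time_C_T:
  assumes hit [measurable]: "\<And>b. hitting_time V (halfspace_ge u b) \<in> borel_measurable M"
    and sup: "\<And>t. 0 \<le> t \<Longrightarrow> running_sup V u t \<in> borel_measurable M"
    and atomless: "\<And>t b. 0 < t \<Longrightarrow> prob {\<omega> \<in> space M. running_sup V u t \<omega> = ereal b} = 0"
    and wd: "well_defined_Inf (CT_set M V tr u)"
  shows "mean_hitting_time M V (halfspace_ge u (C_T M V tr u)) = ennreal tr"
proof -
  define c where "c = C_T M V tr u"
  have mono: "mean_hitting_time M V (halfspace_ge u b) \<le> mean_hitting_time M V (halfspace_ge u b')"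
    if "b \<le> b'" for b b'
    unfolding mean_hitting_time_def
    by (intro nn_integral_mono hitting_time_antimono halfspace_ge_antimono that)
  obtain d where d: "d \<in> CT_set M V tr u"
    using wd by (auto simp: well_defined_Inf_def)
  have c_le: "c \<le> b" if "b \<in> CT_set M V tr u" for b
    unfolding c_def C_T_def by (rule cInf_lower) (use wd that in \<open>auto simp: well_defined_Inf_def\<close>)
  \<comment> \<open>Capping at \<open>d\<close> keeps the expectations finite, as monotone convergence from above requires.\<close>
  define a where "a n = min d (c + inverse (real (Suc n)))" for n
  let ?h = "\<lambda>b. hitting_time V (halfspace_ge u b)"
  have ge: "c \<le> a n" for n
    using c_le[OF d] by (simp add: a_def)
  \<comment> \<open>Each \<open>a n\<close> lies between two members of \<open>CT_set\<close>,
    namely \<open>min d b\<close> and \<open>d\<close>, so monotonicity in the level squeezes the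
    mean.\<close>
  have mean_a: "mean_hitting_time M V (halfspace_ge u (a n)) = ennreal tr" for n
  proof (rule antisym)
    have "mean_hitting_time M V (halfspace_ge u (a n)) \<le> mean_hitting_time M V (halfspace_ge u d)"
      by (rule mono) (simp add: a_def)
    then show "mean_hitting_time M V (halfspace_ge u (a n)) \<le> ennreal tr"
      using d by (simp add: CT_set_def)
    obtain b where b: "b \<in> CT_set M V tr u" "b < c + inverse (real (Suc n))"
      using wd unfolding c_def C_T_def well_defined_Inf_def by (meson Inf_add_inverse_greater)
    have "min d b \<in> CT_set M V tr u"
      using d b(1) by (simp add: min_def)
    then have "ennreal tr = mean_hitting_time M V (halfspace_ge u (min d b))"
      by (simp add: CT_set_def)
    also have "\<dots> \<le> mean_hitting_time M V (halfspace_ge u (a n))"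
      by (rule mono) (use b(2) in \<open>auto simp: a_def\<close>)
    finally show "ennreal tr \<le> mean_hitting_time M V (halfspace_ge u (a n))" .
  qed
  have "(\<lambda>n. c + inverse (real (Suc n))) \<longlonglongrightarrow> c + 0"
    by (intro tendsto_intros LIMSEQ_inverse_real_of_nat)
  then have "a \<longlonglongrightarrow> min d (c + 0)"
    unfolding a_def by (intro tendsto_min tendsto_const)
  then have lim: "a \<longlonglongrightarrow> c"
    using c_le[OF d] by (simp add: min_absorb2)
  have a_Suc: "a (Suc n) \<le> a n" for n
    unfolding a_def by (intro min.mono add_left_mono le_imp_inverse_le) auto
  have "mean_hitting_time M V (halfspace_ge u c) = (\<integral>\<^sup>+\<omega>. (INF n. ?h (a n) \<omega>) \<partial>M)"
    unfolding mean_hitting_time_def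
    by (intro nn_integral_cong_AE AE_hitting_time_halfspace_ge_eq_INF[OF sup atomless lim ge])
  also have "\<dots> = (INF n. \<integral>\<^sup>+\<omega>. ?h (a n) \<omega> \<partial>M)"
  proof (rule nn_integral_monotone_convergence_INF_AE')
    show "AE \<omega> in M. ?h (a (Suc n)) \<omega> \<le> ?h (a n) \<omega>" for n
      by (intro AE_I2 hitting_time_antimono halfspace_ge_antimono a_Suc)
    show "(\<integral>\<^sup>+\<omega>. ?h (a 0) \<omega> \<partial>M) < \<infinity>"
      using mean_a[of 0] by (simp add: mean_hitting_time_def)
  qed measurable
  also have "\<dots> = ennreal tr"
    using mean_a by (simp add: mean_hitting_time_def)
  finally show ?thesis
    by (simp add: c_def)
qed

end

text \<open>Right continuity in the quantile part controls visits accumulating just after the fixed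
  time \<open>ts\<close>; the return period part instead compares at rational times strictly after
  the hitting time. Both bounds are proved for \<open>rel_frontier\<close> and transferred to
  \<open>frontier\<close> when the interior is nonempty.\<close>

theorem proposition5p8:
  fixes M :: "'w measure" and F :: "real \<Rightarrow> 'w measure"
    and V :: "real \<Rightarrow> 'w \<Rightarrow> real ^ 'n" and x :: "real ^ 'n"
  assumes "prob_space M"
    and "filtration (space M) F"
    and "\<forall>t. subalgebra M (F t)"
    and "progressively_measurable F V"
    and hitting_measurable: "\<forall>A. convex A \<longrightarrow> hitting_time V A \<in> borel_measurable M"
    and sup_measurable: "\<forall>u\<in>sphere 0 1. \<forall>t\<ge>0. running_sup V u t \<in> borel_measurable M"
    and sup_atomless: "\<forall>u\<in>sphere 0 1. \<forall>t>0. \<forall>b::ereal. \<P>(\<omega> in M. running_sup V u t \<omega> = b) = 0"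
  shows
    "(\<forall>ts qs. right_continuous_paths M V \<and> 0 < ts \<and> 0 < qs \<and> qs < 1 \<and>
        (\<forall>u\<in>sphere 0 1. well_defined_Inf (CQ_set M V ts qs u)) \<and>
        bdd_above (C_Q M V ts qs ` sphere 0 1) \<longrightarrow>
        (let B = contour_body x (C_Q M V ts qs) in
           convex B \<and> compact B \<and> Q_s rel_frontier M V ts B \<ge> qs \<and>
           (interior B \<noteq> {} \<longrightarrow> Q_s frontier M V ts B \<ge> qs)))
     \<and>
     (\<forall>tr. 0 < tr \<and>
        (\<forall>u\<in>sphere 0 1. well_defined_Inf (CT_set M V tr u)) \<and>
        bdd_above (C_T M V tr ` sphere 0 1) \<longrightarrow>
        (let B = contour_body x (C_T M V tr) in
           convex B \<and> compact B \<and> T_r rel_frontier M V B \<ge> ennreal tr \<and>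
           (interior B \<noteq> {} \<longrightarrow> T_r frontier M V B \<ge> ennreal tr)))"
proof -
  interpret prob_space M by fact
  have hit: "hitting_time V A \<in> borel_measurable M" if "convex A" for A
    using hitting_measurable that by blast
  have sup: "running_sup V u t \<in> borel_measurable M" if "u \<in> sphere 0 1" "0 \<le> t" for u t
    using sup_measurable that by blast
  have atomless: "prob {\<omega> \<in> space M. running_sup V u t \<omega> = ereal b} = 0"
    if "u \<in> sphere 0 1" "0 < t" for u t b
    using sup_atomless that by blast
  have quantile: "qs \<le> Q_s rel_frontier M V ts (contour_body x (C_Q M V ts qs))"
    if rc: "right_continuous_paths M V" and ts: "0 < ts"
      and wd: "\<forall>u\<in>sphere 0 1. well_defined_Inf (CQ_set M V ts qs u)" for ts qs
    unfolding Q_s_def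
  proof (rule cINF_greatest)
    \<comment> \<open>\<open>Q_s\<close> is an infimum of reals, so the lower bound needs a nonempty
      family; the empty set is always a member.\<close>
    show "outer_sets rel_frontier (contour_body x (C_Q M V ts qs)) \<noteq> {}"
      by (auto simp: outer_sets_def intro!: exI[of _ "{}"])
  next
    fix A assume A: "A \<in> outer_sets rel_frontier (contour_body x (C_Q M V ts qs))"
    then obtain u where u: "u \<in> sphere 0 1" and sub: "A \<subseteq> halfspace_ge u (C_Q M V ts qs u)"
      by (rule outer_set_subset_halfspace)
    have [measurable]: "hitting_time V A \<in> borel_measurable M"
      using A by (intro hit) (simp add: outer_sets_def)
    have "qs \<le> survival_prob M V ts (halfspace_ge u (C_Q M V ts qs u))"
      using ts rc u wd by (intro survival_prob_C_Q_ge hit sup atomless) auto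
    also have "\<dots> \<le> survival_prob M V ts A"
      unfolding survival_prob_def
      by (intro finite_measure_mono) (auto intro: less_le_trans hitting_time_antimono[OF sub])
    finally show "qs \<le> survival_prob M V ts A" .
  qed
  have return_period: "ennreal tr \<le> T_r rel_frontier M V (contour_body x (C_T M V tr))"
    if wd: "\<forall>u\<in>sphere 0 1. well_defined_Inf (CT_set M V tr u)" for tr
    unfolding T_r_def
  proof (rule INF_greatest)
    fix A assume "A \<in> outer_sets rel_frontier (contour_body x (C_T M V tr))"
    then obtain u where u: "u \<in> sphere 0 1" and sub: "A \<subseteq> halfspace_ge u (C_T M V tr u)"
      by (rule outer_set_subset_halfspace)
    have "ennreal tr = mean_hitting_time M V (halfspace_ge u (C_T M V tr u))"
      using u wd by (intro mean_hitting_time_C_T[symmetric] hit sup atomless) auto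
    also have "\<dots> \<le> mean_hitting_time M V A"
      unfolding mean_hitting_time_def by (intro nn_integral_mono hitting_time_antimono sub)
    finally show "ennreal tr \<le> mean_hitting_time M V A" .
  qed
  have "Q_s frontier M V ts B = Q_s rel_frontier M V ts B"
    "T_r frontier M V B = T_r rel_frontier M V B" if "interior B \<noteq> {}" for ts B
    using outer_sets_frontier[OF that] by (simp_all add: Q_s_def T_r_def)
  then show ?thesis
    using quantile return_period by (simp add: Let_def compact_contour_body)
qed

end
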